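(* Let $a_1,\dots,a_{2n}$ be real numbers and let $b_1\le b_2\le\cdots\le b_{2n}$ be the same numbers sorted in nondecreasing order (with multiplicity). Then $$\sum_{i=1}^n b_i b_{2n-i+1}\le\sum_{i=1}^n a_{2i-1}a_{2i}\le\sum_{i=1}^n b_{2i-1}b_{2i}.$$ If in addition $a_i\ge 0$ for all $i$, then $$\prod_{i=1}^n (b_{2i-1}+b_{2i})\le\prod_{i=1}^n (a_{2i-1}+a_{2i})\le\prod_{i=1}^n (b_i+b_{2n-i+1}).$$ *)

theory Defs
  imports Complex_Main "HOL-Library.Multiset"
begin

end

theory Submission
  imports Defs
begin

text \<open>
  All four bounds are instances of one statement about a symmetric function \<open>f\<close> with
  increasing differences, \<open>f u v' + f u' v \<le> f u v + f u' v'\<close> for \<open>u \<le> u'\<close> and \<open>v \<le> v'\<close>: among all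
  perfect matchings of \<open>b 1, \<dots>, b (2 * n)\<close>, the sum of \<open>f\<close> over the pairs is largest when neighbours
  are matched and smallest when the smallest is matched with the largest, and so on inwards.
  If \<open>p\<close> and \<open>q\<close> are the two largest numbers (respectively the smallest and the largest)
  and they are matched with \<open>x\<close> and \<open>y\<close>, then replacing the pairs \<open>{p, x}\<close>, \<open>{q, y}\<close>
  by \<open>{p, q}\<close>, \<open>{x, y}\<close> does not decrease (respectively increase) the sum; remove \<open>{p, q}\<close> and induct.
  The sums of products are the case \<open>f x y = x * y\<close>. The products of sums are, for positive numbers,
  the case \<open>f x y = - ln (x + y)\<close>; nonnegative numbers follow by adding \<open>e > 0\<close> to every number
  and letting \<open>e\<close> tend to 0.
\<close>

text \<open>A multiset of ordered pairs encodes a perfect matching of numbers that may repeat. The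
  order inside a pair is arbitrary, which is harmless because the functions summed over matchings
  below are symmetric.\<close>

definition endpoints :: "('a \<times> 'a) multiset \<Rightarrow> 'a multiset" where
  "endpoints P = image_mset fst P + image_mset snd P"

definition pair_sum :: "('a \<Rightarrow> 'a \<Rightarrow> 'b::comm_monoid_add) \<Rightarrow> ('a \<times> 'a) multiset \<Rightarrow> 'b" where
  "pair_sum f P = (\<Sum>z\<in>#P. f (fst z) (snd z))"

lemma endpoints_add_mset [simp]:
  "endpoints (add_mset z P) = add_mset (fst z) (add_mset (snd z) (endpoints P))"
  by (simp add: endpoints_def)

lemma pair_sum_add_mset [simp]:
  "pair_sum f (add_mset z P) = f (fst z) (snd z) + pair_sum f P"
  by (simp add: pair_sum_def)

lemma endpoints_eq_empty_iff [simp]: "endpoints P = {#} \<longleftrightarrow> P = {#}"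
  by (auto simp: endpoints_def)

lemma pair_sum_empty [simp]: "pair_sum f {#} = 0"
  by (simp add: pair_sum_def)

lemma extract_pair:
  assumes sym: "\<And>x y. f x y = f y x" and p: "p \<in># endpoints P"
  obtains x Q where "endpoints P = add_mset p (add_mset x (endpoints Q))"
    and "pair_sum f P = f p x + pair_sum f Q"
proof -
  from p obtain z where z: "z \<in># P" and "p = fst z \<or> p = snd z"
    by (auto simp: endpoints_def)
  obtain Q where Q: "P = add_mset z Q"
    using z by (meson mset_add)
  from \<open>p = fst z \<or> p = snd z\<close> show thesis
  proof
    assume "p = fst z"
    then show thesis
      using that[of "snd z" Q] Q by simp
  next
    assume "p = snd z"
    then show thesis
      using that[of "fst z" Q] Q sym[of "fst z" "snd z"] by (simp add: add_mset_commute)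
  qed
qed

text \<open>One induction step for both extremal matchings. In either case \<open>Q\<close> is a
  matching of the remaining numbers \<open>M\<close>, so an induction hypothesis applies to it. In
  the second case \<open>Q\<close> already contains a pair of \<open>x\<close> and \<open>y\<close>,
  hence the correction \<open>- f x y\<close>.\<close>

lemma exchange_pairs:
  fixes f :: "'a \<Rightarrow> 'a \<Rightarrow> 'b::ab_group_add"
  assumes sym: "\<And>x y. f x y = f y x" and P: "endpoints P = add_mset p (add_mset q M)"
  obtains Q where "endpoints Q = M" "pair_sum f P = f p q + pair_sum f Q"
  | Q x y where "endpoints Q = M" "x \<in># M" "y \<in># M"
    "pair_sum f P = f p x + f q y - f x y + pair_sum f Q"
proof -
  obtain x Q where Q: "endpoints P = add_mset p (add_mset x (endpoints Q))"
    "pair_sum f P = f p x + pair_sum f Q"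
    using extract_pair[of f p P] sym P by auto
  have eq: "add_mset x (endpoints Q) = add_mset q M"
    using P Q by simp
  show thesis
  proof (cases "x = q")
    case True
    then show thesis
      using that(1)[of Q] eq Q by simp
  next
    case False
    then have "q \<in># endpoints Q"
      using eq by (metis insert_noteq_member)
    then obtain y R where R: "endpoints Q = add_mset q (add_mset y (endpoints R))"
      "pair_sum f Q = f q y + pair_sum f R"
      using extract_pair[of f q Q] sym by auto
    have M: "M = add_mset x (add_mset y (endpoints R))"
      using eq R by (simp add: add_mset_commute)
    show thesis
      using that(2)[of "add_mset (x, y) R" x y] M Q R by simp
  qed
qed

text \<open>Increasing differences are demanded only on a set \<open>S\<close> containing the
  numbers, since \<open>- ln (x + y)\<close> has them on positive reals only.\<close>

lemma pair_sum_le_adjacent: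
  fixes f :: "'a::linorder \<Rightarrow> 'a \<Rightarrow> real" and n :: nat
  assumes sym: "\<And>x y. f x y = f y x"
    and incr: "\<And>u u' v v'. {u, u', v, v'} \<subseteq> S \<Longrightarrow> u \<le> u' \<Longrightarrow> v \<le> v' \<Longrightarrow>
      f u v' + f u' v \<le> f u v + f u' v'"
    and "mono_on {1..2 * n} b" "b ` {1..2 * n} \<subseteq> S"
    and "endpoints P = image_mset b (mset_set {1..2 * n})"
  shows "pair_sum f P \<le> (\<Sum>i = 1..n. f (b (2 * i - 1)) (b (2 * i)))"
  using assms(3-)
proof (induction n arbitrary: P)
  case 0
  then show ?case by simp
next
  case (Suc n)
  let ?p = "b (2 * n + 1)" and ?q = "b (2 * n + 2)" and ?M = "image_mset b (mset_set {1..2 * n})"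
  have ivl: "{1..2 * Suc n} = insert (2 * n + 1) (insert (2 * n + 2) {1..2 * n})"
    by auto
  have P: "endpoints P = add_mset ?p (add_mset ?q ?M)"
    using Suc.prems(3) unfolding ivl by simp
  have IH: "pair_sum f Q \<le> (\<Sum>i = 1..n. f (b (2 * i - 1)) (b (2 * i)))"
    if "endpoints Q = ?M" for Q
    using that Suc.prems by (intro Suc.IH) (auto intro: mono_on_subset)
  have sum: "(\<Sum>i = 1..Suc n. f (b (2 * i - 1)) (b (2 * i))) =
    (\<Sum>i = 1..n. f (b (2 * i - 1)) (b (2 * i))) + f ?p ?q"
    by simp
  from P show ?case
  proof (cases rule: exchange_pairs[of f, OF sym, consumes 1, case_names matched exchanged])
    case (matched Q)
    then show ?thesis
      using matched IH[of Q] sum by simp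
  next
    case (exchanged Q x y)
    from exchanged obtain i j where ij: "i \<in> {1..2 * n}" "x = b i" "j \<in> {1..2 * n}" "y = b j"
      by auto
    \<comment> \<open>Each partner is compared with the top number it was not matched with, so that
      the increments run from \<open>x\<close> to \<open>?q\<close> and from \<open>y\<close> to
      \<open>?p\<close>.\<close>
    have "x \<le> ?q" "y \<le> ?p"
      using ij by (auto intro!: mono_onD[OF Suc.prems(1)])
    moreover have "{x, y, ?p, ?q} \<subseteq> S"
      using ij Suc.prems(2) by auto
    ultimately have "f x ?p + f ?q y \<le> f x y + f ?q ?p"
      by (intro incr) auto
    then show ?thesis
      using exchanged IH[of Q] sum sym[of x ?p] sym[of ?p ?q] by simp
  qed
qed

lemma nested_le_pair_sum:
  fixes f :: "'a::linorder \<Rightarrow> 'a \<Rightarrow> real" and n :: nat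
  assumes sym: "\<And>x y. f x y = f y x"
    and incr: "\<And>u u' v v'. {u, u', v, v'} \<subseteq> S \<Longrightarrow> u \<le> u' \<Longrightarrow> v \<le> v' \<Longrightarrow>
      f u v' + f u' v \<le> f u v + f u' v'"
    and "mono_on {1..2 * n} b" "b ` {1..2 * n} \<subseteq> S"
    and "endpoints P = image_mset b (mset_set {1..2 * n})"
  shows "(\<Sum>i = 1..n. f (b i) (b (2 * n - i + 1))) \<le> pair_sum f P"
  using assms(3-)
\<comment> \<open>Here \<open>b\<close> must vary: removing \<open>b 1\<close> leaves a sequence
  starting at index 2, so the hypothesis is used for \<open>\<lambda>i. b (Suc i)\<close>.\<close>
proof (induction n arbitrary: P b)
  case 0
  then show ?case by simp
next
  case (Suc n)
  let ?p = "b 1" and ?q = "b (2 * n + 2)"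
    and ?M = "image_mset (\<lambda>i. b (Suc i)) (mset_set {1..2 * n})"
  have ivl: "{1..2 * Suc n} = insert 1 (insert (2 * n + 2) (Suc ` {1..2 * n}))"
    by (auto simp: image_Suc_atLeastAtMost)
  have "image_mset b (mset_set (Suc ` {1..2 * n})) = ?M"
    by (subst image_mset_mset_set[symmetric]) (auto simp: multiset.map_comp o_def)
  then have P: "endpoints P = add_mset ?p (add_mset ?q ?M)"
    using Suc.prems(3) unfolding ivl by (subst (asm) mset_set.insert; simp)+
  have IH: "(\<Sum>i = 1..n. f (b (Suc i)) (b (Suc (2 * n - i + 1)))) \<le> pair_sum f Q"
    if "endpoints Q = ?M" for Q
    using that Suc.prems by (intro Suc.IH) (auto simp: mono_on_def)
  have "(\<Sum>i = 1..Suc n. f (b i) (b (2 * Suc n - i + 1))) =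
    f ?p ?q + (\<Sum>i = Suc 1..Suc n. f (b i) (b (2 * Suc n - i + 1)))"
    by (subst sum.atLeast_Suc_atMost) auto
  also have "(\<Sum>i = Suc 1..Suc n. f (b i) (b (2 * Suc n - i + 1))) =
    (\<Sum>i = 1..n. f (b (Suc i)) (b (Suc (2 * n - i + 1))))"
    unfolding sum.shift_bounds_cl_Suc_ivl by (intro sum.cong) (auto simp: Suc_diff_le)
  finally have sum: "(\<Sum>i = 1..Suc n. f (b i) (b (2 * Suc n - i + 1))) =
    f ?p ?q + (\<Sum>i = 1..n. f (b (Suc i)) (b (Suc (2 * n - i + 1))))" .
  from P show ?case
  proof (cases rule: exchange_pairs[of f, OF sym, consumes 1, case_names matched exchanged])
    case (matched Q)
    then show ?thesis
      using matched IH[of Q] sum by simp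
  next
    case (exchanged Q x y)
    from exchanged obtain i j where ij: "i \<in> {1..2 * n}" "x = b (Suc i)" "j \<in> {1..2 * n}" "y = b (Suc j)"
      by auto
    \<comment> \<open>Now the increments run from \<open>?p\<close> up to \<open>y\<close> and from
      \<open>x\<close> up to \<open>?q\<close>. The pair \<open>?p\<close>, \<open>?q\<close> lands
      on the smaller side, which reverses the effect of the exchange.\<close>
    have "?p \<le> y" "x \<le> ?q"
      using ij by (auto intro!: mono_onD[OF Suc.prems(1)])
    moreover have "{x, y, ?p, ?q} \<subseteq> S"
      using ij Suc.prems(2) by auto
    ultimately have "f ?p ?q + f y x \<le> f ?p x + f y ?q"
      by (intro incr) auto
    then show ?thesis
      using exchanged IH[of Q] sum sym[of x y] sym[of y ?q] by simp
  qed
qed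

lemma endpoints_consecutive:
  fixes n :: nat
  shows "endpoints (image_mset (\<lambda>i. (a (2 * i - 1), a (2 * i))) (mset_set {1..n})) =
    image_mset a (mset_set {1..2 * n})"
proof (induction n)
  case 0
  then show ?case by simp
next
  case (Suc n)
  have "{1..2 * Suc n} = insert (2 * n + 1) (insert (2 * n + 2) {1..2 * n})"
    by auto
  moreover have "{1..Suc n} = insert (Suc n) {1..n}"
    by auto
  ultimately show ?case
    using Suc by simp
qed

lemma pair_sum_consecutive:
  fixes n :: nat
  shows "pair_sum f (image_mset (\<lambda>i. (a (2 * i - 1), a (2 * i))) (mset_set {1..n})) =
    (\<Sum>i = 1..n. f (a (2 * i - 1)) (a (2 * i)))"
  by (simp add: pair_sum_def sum_unfold_sum_mset multiset.map_comp o_def)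

lemma matching_bounds:
  fixes f :: "'a::linorder \<Rightarrow> 'a \<Rightarrow> real" and n :: nat
  assumes "\<And>x y. f x y = f y x"
    and "\<And>u u' v v'. {u, u', v, v'} \<subseteq> S \<Longrightarrow> u \<le> u' \<Longrightarrow> v \<le> v' \<Longrightarrow>
      f u v' + f u' v \<le> f u v + f u' v'"
    and "mono_on {1..2 * n} b" "b ` {1..2 * n} \<subseteq> S"
    and "image_mset b (mset_set {1..2 * n}) = image_mset a (mset_set {1..2 * n})"
  shows "(\<Sum>i = 1..n. f (b i) (b (2 * n - i + 1))) \<le> (\<Sum>i = 1..n. f (a (2 * i - 1)) (a (2 * i)))"
    and "(\<Sum>i = 1..n. f (a (2 * i - 1)) (a (2 * i))) \<le> (\<Sum>i = 1..n. f (b (2 * i - 1)) (b (2 * i)))"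
proof -
  let ?P = "image_mset (\<lambda>i. (a (2 * i - 1), a (2 * i))) (mset_set {1..n})"
  have P: "endpoints ?P = image_mset b (mset_set {1..2 * n})"
    unfolding assms(5) by (rule endpoints_consecutive)
  show "(\<Sum>i = 1..n. f (b i) (b (2 * n - i + 1))) \<le> (\<Sum>i = 1..n. f (a (2 * i - 1)) (a (2 * i)))"
    using nested_le_pair_sum[of f S n b ?P] assms P unfolding pair_sum_consecutive by blast
  show "(\<Sum>i = 1..n. f (a (2 * i - 1)) (a (2 * i))) \<le> (\<Sum>i = 1..n. f (b (2 * i - 1)) (b (2 * i)))"
    using pair_sum_le_adjacent[of f S n b ?P] assms P unfolding pair_sum_consecutive by blast
qed

text \<open>The product \<open>(u + v') * (u' + v)\<close> exceeds
  \<open>(u + v) * (u' + v')\<close> by exactly \<open>(u' - u) * (v' - v)\<close>. Taking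
  logarithms and negating gives the claim.\<close>

lemma neg_ln_add_increasing_differences:
  fixes u u' v v' :: real
  assumes "{u, u', v, v'} \<subseteq> {0<..}" "u \<le> u'" "v \<le> v'"
  shows "- ln (u + v') + - ln (u' + v) \<le> - ln (u + v) + - ln (u' + v')"
proof -
  have pos: "0 < u" "0 < u'" "0 < v" "0 < v'"
    using assms(1) by auto
  have "0 \<le> (u' - u) * (v' - v)"
    using assms by simp
  then have "(u + v) * (u' + v') \<le> (u + v') * (u' + v)"
    by (simp add: algebra_simps)
  then have "ln ((u + v) * (u' + v')) \<le> ln ((u + v') * (u' + v))"
    using pos by (subst ln_le_cancel_iff) auto
  then show ?thesis
    using pos by (simp add: ln_mult_pos)
qed

lemma image_eq_if_image_mset_eq:
  assumes "image_mset b (mset_set A) = image_mset a (mset_set A)" "finite A"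
  shows "b ` A = a ` A"
  using arg_cong[OF assms(1), of set_mset] assms(2) by simp

lemma prod_le_if_sum_ln_le:
  fixes f g :: "'a \<Rightarrow> real"
  assumes "finite A" "\<And>x. x \<in> A \<Longrightarrow> f x > 0" "\<And>x. x \<in> A \<Longrightarrow> g x > 0"
    and "(\<Sum>x\<in>A. ln (f x)) \<le> (\<Sum>x\<in>A. ln (g x))"
  shows "prod f A \<le> prod g A"
proof -
  have "exp (\<Sum>x\<in>A. ln (h x)) = prod h A" if "\<And>x. x \<in> A \<Longrightarrow> h x > 0" for h :: "'a \<Rightarrow> real"
    using that by (simp add: exp_sum assms(1))
  then show ?thesis
    using assms by (metis exp_le_cancel_iff)
qed

lemma prod_bounds_pos:
  fixes a b :: "nat \<Rightarrow> real"
  assumes same: "image_mset b (mset_set {1..2 * n}) = image_mset a (mset_set {1..2 * n})"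
    and mono: "mono_on {1..2 * n} b"
    and pos: "\<And>i. i \<in> {1..2 * n} \<Longrightarrow> a i > 0"
  shows "(\<Prod>i = 1..n. b (2 * i - 1) + b (2 * i)) \<le> (\<Prod>i = 1..n. a (2 * i - 1) + a (2 * i))"
    and "(\<Prod>i = 1..n. a (2 * i - 1) + a (2 * i)) \<le> (\<Prod>i = 1..n. b i + b (2 * n - i + 1))"
proof -
  have b: "b ` {1..2 * n} \<subseteq> {0<..}"
    using image_eq_if_image_mset_eq[OF same] pos by auto
  then have posb: "b i > 0" if "i \<in> {1..2 * n}" for i
    using that by (meson greaterThan_iff image_subset_iff)
  have A: "a (2 * i - 1) + a (2 * i) > 0" and B: "b (2 * i - 1) + b (2 * i) > 0"
    and C: "b i + b (2 * n - i + 1) > 0" if "i \<in> {1..n}" for i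
    using that by (auto intro!: add_pos_pos pos posb)
  \<comment> \<open>The minus sign swaps the roles: the adjacent matching maximizes the sum of
    \<open>- ln (x + y)\<close> and so minimizes the product, while the nested one maximizes the
    product.\<close>
  note bounds = matching_bounds[of "\<lambda>x y. - ln (x + y)" "{0<..}" n b a,
      OF _ neg_ln_add_increasing_differences mono b same]
  show "(\<Prod>i = 1..n. b (2 * i - 1) + b (2 * i)) \<le> (\<Prod>i = 1..n. a (2 * i - 1) + a (2 * i))"
    using bounds(2) A B by (intro prod_le_if_sum_ln_le) (auto simp: sum_negf add.commute)
  show "(\<Prod>i = 1..n. a (2 * i - 1) + a (2 * i)) \<le> (\<Prod>i = 1..n. b i + b (2 * n - i + 1))"
    using bounds(1) A C by (intro prod_le_if_sum_ln_le) (auto simp: sum_negf add.commute)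
qed

lemma prod_bounds_nonneg:
  fixes a b :: "nat \<Rightarrow> real"
  assumes same: "image_mset b (mset_set {1..2 * n}) = image_mset a (mset_set {1..2 * n})"
    and mono: "mono_on {1..2 * n} b"
    and nonneg: "\<And>i. i \<in> {1..2 * n} \<Longrightarrow> a i \<ge> 0"
  shows "(\<Prod>i = 1..n. b (2 * i - 1) + b (2 * i)) \<le> (\<Prod>i = 1..n. a (2 * i - 1) + a (2 * i))"
    and "(\<Prod>i = 1..n. a (2 * i - 1) + a (2 * i)) \<le> (\<Prod>i = 1..n. b i + b (2 * n - i + 1))"
proof -
  define A where "A e = (\<Prod>i = 1..n. (a (2 * i - 1) + e) + (a (2 * i) + e))" for e
  define B where "B e = (\<Prod>i = 1..n. (b (2 * i - 1) + e) + (b (2 * i) + e))" for e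
  define C where "C e = (\<Prod>i = 1..n. (b i + e) + (b (2 * n - i + 1) + e))" for e
  have bounds: "B e \<le> A e \<and> A e \<le> C e" if "e > 0" for e
  proof -
    have "image_mset (\<lambda>i. b i + e) (mset_set {1..2 * n}) =
      image_mset (\<lambda>i. a i + e) (mset_set {1..2 * n})"
      using arg_cong[OF same, of "image_mset (\<lambda>x. x + e)"] by (simp add: multiset.map_comp o_def)
    moreover have "mono_on {1..2 * n} (\<lambda>i. b i + e)"
      using mono by (auto simp: mono_on_def)
    moreover have "a i + e > 0" if "i \<in> {1..2 * n}" for i
      using nonneg[OF that] \<open>e > 0\<close> by simp
    ultimately show ?thesis
      unfolding A_def B_def C_def using prod_bounds_pos by blast
  qed
  \<comment> \<open>All three are polynomials in \<open>e\<close>, so their values at 0, the wanted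
    products, are their limits from the right, and weak inequalities survive the limit.\<close>
  have "isCont A 0" "isCont B 0" "isCont C 0"
    unfolding A_def B_def C_def by (intro continuous_intros)+
  then have lim: "(A \<longlongrightarrow> A 0) (at_right 0)" "(B \<longlongrightarrow> B 0) (at_right 0)" "(C \<longlongrightarrow> C 0) (at_right 0)"
    by (auto simp: isCont_def intro: filterlim_at_split[THEN iffD1, THEN conjunct2])
  have "B 0 \<le> A 0" "A 0 \<le> C 0"
    using bounds by (auto intro!: tendsto_le[OF _ lim(1,2)] tendsto_le[OF _ lim(3,1)]
        eventually_at_right_less[THEN eventually_mono])
  then show "(\<Prod>i = 1..n. b (2 * i - 1) + b (2 * i)) \<le> (\<Prod>i = 1..n. a (2 * i - 1) + a (2 * i))"
    and "(\<Prod>i = 1..n. a (2 * i - 1) + a (2 * i)) \<le> (\<Prod>i = 1..n. b i + b (2 * n - i + 1))"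
    by (simp_all add: A_def B_def C_def)
qed

theorem corollary5:
  fixes n :: nat and a b :: "nat \<Rightarrow> real"
  assumes same_numbers: "image_mset b (mset_set {1..2 * n}) = image_mset a (mset_set {1..2 * n})"
    and sorted: "mono_on {1..2 * n} b"
  shows "(\<Sum>i = 1..n. b i * b (2 * n - i + 1)) \<le> (\<Sum>i = 1..n. a (2 * i - 1) * a (2 * i)) \<and>
    (\<Sum>i = 1..n. a (2 * i - 1) * a (2 * i)) \<le> (\<Sum>i = 1..n. b (2 * i - 1) * b (2 * i)) \<and>
    ((\<forall>i \<in> {1..2 * n}. a i \<ge> 0) \<longrightarrow>
      (\<Prod>i = 1..n. b (2 * i - 1) + b (2 * i)) \<le> (\<Prod>i = 1..n. a (2 * i - 1) + a (2 * i)) \<and>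
      (\<Prod>i = 1..n. a (2 * i - 1) + a (2 * i)) \<le> (\<Prod>i = 1..n. b i + b (2 * n - i + 1)))"
proof -
  \<comment> \<open>The difference of the two sides is \<open>(u' - u) * (v' - v)\<close>. No sign
    condition on the numbers is involved, so \<open>S\<close> can be \<open>UNIV\<close>.\<close>
  have incr: "u * v' + u' * v \<le> u * v + u' * v'" if "u \<le> u'" "v \<le> v'" for u u' v v' :: real
    using mult_nonneg_nonneg[of "u' - u" "v' - v"] that by (simp add: algebra_simps)
  have "(\<Sum>i = 1..n. b i * b (2 * n - i + 1)) \<le> (\<Sum>i = 1..n. a (2 * i - 1) * a (2 * i))"
    and "(\<Sum>i = 1..n. a (2 * i - 1) * a (2 * i)) \<le> (\<Sum>i = 1..n. b (2 * i - 1) * b (2 * i))"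
    by (rule matching_bounds[of "(*)" UNIV, OF mult.commute incr sorted _ same_numbers]; simp)+
  then show ?thesis
    using prod_bounds_nonneg[OF same_numbers sorted] by blast
qed

end
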